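(* Let $k\ge 3$ be a fixed integer and let $P$ and $Q$ be probability distributions on a finite commutative ring $R$. Then $\alpha_{P,Q}=1$ if and only if $\ell(P,Q)=\infty$.
   Context: Rings are finite, commutative, with identity; $(r)=rR$. Definition of $\alpha_{P,Q}$. A factor graph $F$ is a finite bipartite graph with vertex classes $V(F)$ (variable vertices) and $C(F)$ (constraint vertices), in which every constraint vertex has degree exactly $k$. A weighted factor graph $(F,w)$ carries a weight $w(cv)\in R$ on every edge $cv$ and a weight $w(c)\in R$ on every constraint vertex $c$. It is satisfiable if there is $x\in R^{V(F)}$ with $\sum_{v\in N(c)}w(cv)x_v=w(c)$ for every $c\in C(F)$, and unsatisfiable otherwise. $\mathcal T(P,Q)$ is the set of unsatisfiable, connected, acyclic weighted factor graphs with all edge weights in $\operatorname{supp}(P)$ and all constraint vertex weights in $\operatorname{supp}(Q)$. Set $$\alpha_{P,Q}=1-\frac{1}{\inf\{|C(T)|:T\in\mathcal T(P,Q)\}},$$ with $\alpha_{P,Q}=1$ if $\mathcal T(P,Q)=\emptyset$. Definition of $\ell(P,Q)$. For an ideal $I$ and $s\in R$, $(I:s)=\{t\in R: st\in I\}$. Define $I_0(P)=\bigcap_{r\in\operatorname{supp}(P)}(r)$ and, for $\ell\ge1$, $$I_\ell(P)=\bigcap_{r\in\operatorname{supp}(P)}r\Big(\bigcap_{s\in\operatorname{supp}(P)}(I_{\ell-1}(P):s)\Big).$$ Then $\ell(P,Q)=\inf\{\ell\ge0:\operatorname{supp}(Q)\not\subseteq I_\ell(P)\}$, with $\inf\emptyset=\infty$.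 *)

theory Defs
  imports "HOL-Probability.Probability_Mass_Function" "HOL-Library.Extended_Nat"
begin

text \<open>
  Finite commutative rings with identity are types of sort
  \<open>{finite, comm_ring, comm_monoid_mult}\<close>. Unlike \<open>comm_ring_1\<close>, this does not
  impose \<open>0 \<noteq> 1\<close>, so the zero ring is included.
\<close>

section \<open>Weighted factor graphs\<close>

text \<open>
  Edges are two-element sets \<open>{c, v}\<close> (the graph is simple). The weight functions are
  total, but only their values on edges and on constraint vertices matter.
\<close>

record ('v, 'r) wfgraph =
  var_verts :: "'v set"
  con_verts :: "'v set"
  edges :: "'v set set"
  edge_wt :: "'v set \<Rightarrow> 'r"
  con_wt :: "'v \<Rightarrow> 'r"

definition nbrs :: "('v, 'r) wfgraph \<Rightarrow> 'v \<Rightarrow> 'v set" where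
  "nbrs F u = {v. {u, v} \<in> edges F}"

definition factor_graph :: "nat \<Rightarrow> ('v, 'r) wfgraph \<Rightarrow> bool" where
  "factor_graph k F \<longleftrightarrow>
     finite (var_verts F) \<and> finite (con_verts F) \<and>
     var_verts F \<inter> con_verts F = {} \<and>
     edges F \<subseteq> {{c, v} | c v. c \<in> con_verts F \<and> v \<in> var_verts F} \<and>
     (\<forall>c\<in>con_verts F. card (nbrs F c) = k)"

definition connected_graph :: "('v, 'r) wfgraph \<Rightarrow> bool" where
  "connected_graph F \<longleftrightarrow>
     (\<forall>u \<in> var_verts F \<union> con_verts F. \<forall>v \<in> var_verts F \<union> con_verts F.
        (u, v) \<in> {(a, b). {a, b} \<in> edges F}\<^sup>*)"

definition graph_cycle :: "('v, 'r) wfgraph \<Rightarrow> 'v list \<Rightarrow> bool" where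
  "graph_cycle F vs \<longleftrightarrow>
     length vs \<ge> 3 \<and> distinct vs \<and>
     successively (\<lambda>a b. {a, b} \<in> edges F) vs \<and> {last vs, hd vs} \<in> edges F"

definition acyclic_graph :: "('v, 'r) wfgraph \<Rightarrow> bool" where
  "acyclic_graph F \<longleftrightarrow> (\<nexists>vs. graph_cycle F vs)"

definition satisfiable :: "('v, 'r::comm_ring) wfgraph \<Rightarrow> bool" where
  "satisfiable F \<longleftrightarrow>
     (\<exists>x :: 'v \<Rightarrow> 'r. \<forall>c\<in>con_verts F. (\<Sum>v\<in>nbrs F c. edge_wt F {c, v} * x v) = con_wt F c)"

text \<open>
  Since factor graphs are finite, every one is isomorphic to one whose vertices are natural
  numbers; this makes the class of all such graphs a set.
\<close>

definition unsat_trees ::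
  "nat \<Rightarrow> 'r::comm_ring pmf \<Rightarrow> 'r pmf \<Rightarrow> (nat, 'r) wfgraph set" where
  "unsat_trees k P Q =
     {T. factor_graph k T \<and> connected_graph T \<and> acyclic_graph T \<and> \<not> satisfiable T \<and>
         (\<forall>e\<in>edges T. edge_wt T e \<in> set_pmf P) \<and>
         (\<forall>c\<in>con_verts T. con_wt T c \<in> set_pmf Q)}"

definition alpha :: "nat \<Rightarrow> 'r::comm_ring pmf \<Rightarrow> 'r pmf \<Rightarrow> real" where
  "alpha k P Q =
     (if unsat_trees k P Q = {} then 1
      else 1 - 1 / real (INF T \<in> unsat_trees k P Q. card (con_verts T)))"


section \<open>The ideals \<open>I\<^sub>\<ell>(P)\<close>\<close>

definition colon :: "'r::comm_ring set \<Rightarrow> 'r \<Rightarrow> 'r set" where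
  "colon I s = {t. s * t \<in> I}"

primrec I_ideal :: "'r::comm_ring pmf \<Rightarrow> nat \<Rightarrow> 'r set" where
  "I_ideal P 0 = (\<Inter>r\<in>set_pmf P. range (\<lambda>t. r * t))"
| "I_ideal P (Suc l) =
     (\<Inter>r\<in>set_pmf P. (\<lambda>t. r * t) ` (\<Inter>s\<in>set_pmf P. colon (I_ideal P l) s))"

text \<open>In \<^typ>\<open>enat\<close>, the infimum of the empty set is \<open>\<infinity>\<close>.\<close>

definition ell :: "'r::comm_ring pmf \<Rightarrow> 'r pmf \<Rightarrow> enat" where
  "ell P Q = Inf {enat l | l. \<not> set_pmf Q \<subseteq> I_ideal P l}"

end

theory Submission imports Defs
begin

text \<open>
  Write \<open>I\<^sub>n = \<Inter>\<^sub>r r J\<^sub>n\<close> with \<open>J\<^sub>0 = R\<close> and \<open>J\<^sub>n\<^sub>+\<^sub>1 = \<Inter>\<^sub>s (I\<^sub>n : s)\<close>. The chain is decreasing, so it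
  becomes stationary, say at \<open>I\<close> and \<open>J\<close>. If all constraint weights lie in \<open>I\<close>, then a forest has a
  solution with values in \<open>J\<close>: some constraint has a neighbour of degree one; delete this
  constraint, solve the rest, and note that the value required at the leaf can be taken in \<open>J\<close>
  because \<open>I \<subseteq> r J\<close> for every edge weight \<open>r\<close>. Conversely, let \<open>l\<close> be minimal such that some constraint
  weight \<open>q\<close> is not in \<open>I\<^sub>l\<close>, say \<open>q \<notin> r\<^sub>0 J\<^sub>l\<close>. In the tree in which every variable above depth \<open>2 l\<close>
  has a child constraint for each pair of edge weights \<open>(s, r)\<close>, and in which all constraint weights
  are \<open>q\<close>, a variable at height \<open>2 n\<close> is forced to lie in \<open>J\<^sub>n\<close>, so the root constraint fails.
\<close>

section \<open>Ideals of variable values\<close>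

text \<open>This is the inner intersection in the clause for \<open>I\<^sub>n\<close>. Splitting it
  off gives both clauses of \<open>I_ideal\<close> one shape and names the set where values of
  variables live.\<close>

definition var_ideal :: "'r::comm_ring pmf \<Rightarrow> nat \<Rightarrow> 'r set" where
  "var_ideal P n = (case n of 0 \<Rightarrow> UNIV | Suc m \<Rightarrow> \<Inter>s\<in>set_pmf P. colon (I_ideal P m) s)"

lemma var_ideal_0 [simp]: "var_ideal P 0 = UNIV"
  by (simp add: var_ideal_def)

lemma mem_var_ideal_Suc:
  "x \<in> var_ideal P (Suc n) \<longleftrightarrow> (\<forall>s\<in>set_pmf P. s * x \<in> I_ideal P n)"
  by (simp add: var_ideal_def colon_def)

lemma I_ideal_eq: "I_ideal P n = (\<Inter>r\<in>set_pmf P. (\<lambda>t. r * t) ` var_ideal P n)"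
  by (cases n) (simp_all add: var_ideal_def)

lemma mem_I_ideal: "x \<in> I_ideal P n \<longleftrightarrow> (\<forall>r\<in>set_pmf P. \<exists>t\<in>var_ideal P n. x = r * t)"
  by (auto simp: I_ideal_eq)

text \<open>One induction serves both claims: if \<open>s * x = r * t\<close> and
  \<open>s * y = r * u\<close>, then \<open>s * (x - y) = r * (t - u)\<close>.\<close>

lemma var_ideal_subgroup:
  "0 \<in> var_ideal P n" "\<lbrakk>x \<in> var_ideal P n; y \<in> var_ideal P n\<rbrakk> \<Longrightarrow> x - y \<in> var_ideal P n"
proof (induction n arbitrary: x y)
  case 0
  { case 1 then show ?case by simp next case 2 then show ?case by simp }
next
  case (Suc n)
  { case 1 show ?case using Suc.IH(1) by (force simp: mem_var_ideal_Suc mem_I_ideal)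
  next
    case 2
    show ?case
      unfolding mem_var_ideal_Suc mem_I_ideal
    proof (intro ballI)
      fix s r assume s: "s \<in> set_pmf P" and r: "r \<in> set_pmf P"
      obtain t u where "t \<in> var_ideal P n" "s * x = r * t" "u \<in> var_ideal P n" "s * y = r * u"
        using 2 s r unfolding mem_var_ideal_Suc mem_I_ideal by blast
      then show "\<exists>t\<in>var_ideal P n. s * (x - y) = r * t"
        using Suc.IH(2) by (intro bexI[of _ "t - u"]) (simp_all add: algebra_simps)
    qed
  }
qed

lemma var_ideal_sum: "(\<And>i. i \<in> A \<Longrightarrow> f i \<in> var_ideal P n) \<Longrightarrow> sum f A \<in> var_ideal P n"
proof (induction A rule: infinite_finite_induct)
  case (insert a A)
  \<comment> \<open>The sum \<open>f a + sum f A\<close> is written as a difference, because closure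
    is known under subtraction.\<close>
  have "f a - (0 - sum f A) \<in> var_ideal P n"
    using insert by (intro var_ideal_subgroup) auto
  with insert show ?case by simp
qed (simp_all add: var_ideal_subgroup)

lemma I_ideal_diff: "\<lbrakk>x \<in> I_ideal P n; y \<in> I_ideal P n\<rbrakk> \<Longrightarrow> x - y \<in> I_ideal P n"
  unfolding mem_I_ideal by (metis var_ideal_subgroup(2) right_diff_distrib)

lemma I_ideal_0_mem: "0 \<in> I_ideal P n"
  unfolding mem_I_ideal by (metis var_ideal_subgroup(1) mult_zero_right)

lemma I_ideal_sum: "(\<And>i. i \<in> A \<Longrightarrow> f i \<in> I_ideal P n) \<Longrightarrow> sum f A \<in> I_ideal P n"
proof (induction A rule: infinite_finite_induct)
  case (insert a A)
  have "f a - (0 - sum f A) \<in> I_ideal P n"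
    using insert by (intro I_ideal_diff I_ideal_0_mem) auto
  with insert show ?case by simp
qed (simp_all add: I_ideal_0_mem)

text \<open>The steps from \<open>J\<^sub>n\<close> to \<open>I\<^sub>n\<close> and from
  \<open>I\<^sub>n\<close> to \<open>J\<^sub>n\<^sub>+\<^sub>1\<close> are monotone, and
  \<open>J\<^sub>0\<close> is everything.\<close>

lemma var_ideal_Suc_subset: "var_ideal P (Suc n) \<subseteq> var_ideal P n"
proof (induction n)
  case (Suc n)
  show ?case
  proof
    fix x assume x: "x \<in> var_ideal P (Suc (Suc n))"
    have "I_ideal P (Suc n) \<subseteq> I_ideal P n"
      using Suc unfolding mem_I_ideal subset_iff by blast
    with x show "x \<in> var_ideal P (Suc n)"
      unfolding mem_var_ideal_Suc by blast
  qed
qed simp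

text \<open>If \<open>J\<^sub>n\<close> has least cardinality, its subset
  \<open>J\<^sub>n\<^sub>+\<^sub>1\<close> cannot be smaller, so the two agree.\<close>

lemma I_ideal_stabilizes:
  fixes P :: "'r::{finite, comm_ring} pmf"
  obtains n where "I_ideal P (Suc n) = I_ideal P n"
proof -
  obtain n where n: "\<And>m. card (var_ideal P n) \<le> card (var_ideal P m)"
    using ex_has_least_nat[of "\<lambda>_. True" 0 "\<lambda>n. card (var_ideal P n)"] by auto
  have "var_ideal P (Suc n) = var_ideal P n"
    using var_ideal_Suc_subset n by (intro card_seteq) auto
  then show ?thesis by (intro that[of n]) (simp only: I_ideal_eq)
qed


section \<open>Cycles\<close>

text \<open>Take a longest path in \<open>X\<close>. Its first vertex has a neighbour in
  \<open>X\<close> other than the second vertex; by maximality that neighbour is on the path and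
  closes a cycle.\<close>

lemma graph_cycle_exists:
  assumes "finite X" "X \<noteq> {}" and no_loop: "\<And>u. {u} \<notin> edges F"
    and two: "\<And>u. u \<in> X \<Longrightarrow> \<exists>a\<in>X. \<exists>b\<in>X. a \<noteq> b \<and> {u, a} \<in> edges F \<and> {u, b} \<in> edges F"
  shows "\<exists>vs. graph_cycle F vs"
proof -
  define path where "path vs \<longleftrightarrow> vs \<noteq> [] \<and> distinct vs \<and> set vs \<subseteq> X \<and>
      successively (\<lambda>a b. {a, b} \<in> edges F) vs" for vs
  obtain x where "x \<in> X" using \<open>X \<noteq> {}\<close> by blast
  then have "path [x]" by (simp add: path_def)
  moreover have "\<forall>vs. path vs \<longrightarrow> length vs < Suc (card X)"
    using card_mono[OF \<open>finite X\<close>] by (metis path_def distinct_card le_imp_less_Suc)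
  ultimately obtain vs where vs: "path vs" and max: "\<And>ws. path ws \<Longrightarrow> length ws \<le> length vs"
    using ex_has_greatest_nat[of path "[x]" length "Suc (card X)"] by blast
  obtain u ws where uws: "vs = u # ws" using vs by (cases vs) (auto simp: path_def)
  obtain a where a: "a \<in> X" "{u, a} \<in> edges F" "ws = [] \<or> a \<noteq> hd ws"
    using two[of u] vs by (auto simp: path_def uws)
  have "a \<in> set vs"
  proof (rule ccontr)
    assume "a \<notin> set vs"
    then have "path (a # vs)"
      using vs a by (auto simp: path_def uws insert_commute)
    from max[OF this] show False by simp
  qed
  moreover have "a \<noteq> u" using a no_loop by auto
  ultimately obtain ys zs where ws: "ws = ys @ a # zs"
    by (auto simp: uws dest: split_list)
  \<comment> \<open>As \<open>a\<close> is not the second vertex of the path, the closed walk has at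
    least three vertices.\<close>
  with a have "ys \<noteq> []" by auto
  then have "graph_cycle F (u # ys @ [a])"
    using vs a unfolding graph_cycle_def
    by (auto simp: path_def uws ws successively_append_iff successively_Cons insert_commute Suc_le_eq)
  then show ?thesis ..
qed

lemma graph_cycle_nth:
  assumes "graph_cycle F vs" "i < length vs"
  shows "{vs ! i, vs ! (Suc i mod length vs)} \<in> edges F"
proof (cases "Suc i = length vs")
  case True
  then have "last vs = vs ! i" "hd vs = vs ! 0"
    by (metis last_conv_nth list.size(3) nat.simps(3) diff_Suc_1,
        metis hd_conv_nth list.size(3) nat.simps(3))
  with assms True show ?thesis by (simp add: graph_cycle_def)
next
  case False
  with assms show ?thesis by (simp add: graph_cycle_def successively_conv_nth)
qed

text \<open>On a cycle, both neighbours of a vertex of maximal depth \<open>d\<close> would be its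
  parent, yet they are distinct because a cycle has length at least 3.\<close>

lemma acyclic_if_parent:
  fixes d :: "'v \<Rightarrow> nat"
  assumes parent: "\<And>e. e \<in> edges F \<Longrightarrow> \<exists>u. e = {u, p u} \<and> d (p u) < d u"
  shows "acyclic_graph F"
  unfolding acyclic_graph_def
proof
  assume "\<exists>vs. graph_cycle F vs"
  then obtain vs where vs: "graph_cycle F vs" ..
  define n where "n = length vs"
  have n: "n \<ge> 3" "distinct vs" using vs by (auto simp: graph_cycle_def n_def)
  have "\<exists>j<n. \<forall>i<n. d (vs ! i) \<le> d (vs ! j)"
  proof -
    have fin: "finite ((\<lambda>i. d (vs ! i)) ` {..<n})" "(\<lambda>i. d (vs ! i)) ` {..<n} \<noteq> {}"
      using n by (auto simp: lessThan_empty_iff)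
    from Max_in[OF fin] obtain j where "j < n" "d (vs ! j) = Max ((\<lambda>i. d (vs ! i)) ` {..<n})"
      by auto
    with Max_ge[OF fin(1)] show ?thesis by auto
  qed
  then obtain j where j: "j < n" and max: "\<And>i. i < n \<Longrightarrow> d (vs ! i) \<le> d (vs ! j)" by blast
  have top: "vs ! i = p (vs ! j)" if "i < n" "{vs ! j, vs ! i} \<in> edges F" for i
    using parent[OF that(2)] max[OF that(1)] by (fastforce simp: doubleton_eq_iff)
  \<comment> \<open>The cyclic predecessor of \<open>j\<close>.\<close>
  define i where "i = (if j = 0 then n - 1 else j - 1)"
  have i: "i < n" "Suc i mod n = j" using j n by (auto simp: i_def)
  have "vs ! i = p (vs ! j)"
    using graph_cycle_nth[OF vs, of i] i by (intro top) (auto simp: n_def insert_commute)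
  moreover have "vs ! (Suc j mod n) = p (vs ! j)"
    using graph_cycle_nth[OF vs, of j] j by (intro top) (auto simp: n_def intro!: mod_less_divisor)
  ultimately have "i = Suc j mod n"
    using n i(1) j by (metis n_def nth_eq_iff_index_eq mod_less_divisor gr_implies_not0 gr0I)
  then show False
    using j n(1) by (cases "Suc j = n") (auto simp: i_def split: if_splits)
qed


section \<open>Satisfiability of forests\<close>

lemma factor_graph_edge:
  assumes "factor_graph k F" "{u, v} \<in> edges F"
  shows "u \<in> con_verts F \<and> v \<in> var_verts F \<or> v \<in> con_verts F \<and> u \<in> var_verts F"
  using assms unfolding factor_graph_def by (fastforce simp: doubleton_eq_iff)

lemma factor_graph_no_loop:
  assumes "factor_graph k F"
  shows "{u} \<notin> edges F"
  using factor_graph_edge[OF assms, of u u] assms by (auto simp: factor_graph_def)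

lemma finite_nbrs:
  assumes "factor_graph k F"
  shows "finite (nbrs F u)"
proof (rule finite_subset)
  show "nbrs F u \<subseteq> var_verts F \<union> con_verts F"
    using factor_graph_edge[OF assms] by (auto simp: nbrs_def)
  show "finite (var_verts F \<union> con_verts F)" using assms by (simp add: factor_graph_def)
qed

text \<open>Otherwise every variable next to \<open>D\<close> has two neighbours in
  \<open>D\<close>, and every constraint has \<open>k \<ge> 2\<close> neighbours, so
  \<open>D\<close> with its neighbours contains a cycle.\<close>

lemma leaf_variable:
  assumes F: "factor_graph k F" "k \<ge> 2" "acyclic_graph F"
    and D: "D \<subseteq> con_verts F" "D \<noteq> {}"
  shows "\<exists>c\<in>D. \<exists>v\<in>nbrs F c. \<forall>c'\<in>D. v \<in> nbrs F c' \<longrightarrow> c' = c"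
proof (rule ccontr)
  assume no_leaf: "\<not> ?thesis"
  define X where "X = D \<union> (\<Union>c\<in>D. nbrs F c)"
  have "\<exists>vs. graph_cycle F vs"
  proof (rule graph_cycle_exists)
    have "finite D" using F D finite_subset by (auto simp: factor_graph_def)
    then show "finite X" using finite_nbrs[OF F(1)] by (simp add: X_def)
    show "X \<noteq> {}" using D by (simp add: X_def)
    show "{u} \<notin> edges F" for u by (rule factor_graph_no_loop[OF F(1)])
    fix u assume "u \<in> X"
    then consider "u \<in> D" | c where "c \<in> D" "u \<in> nbrs F c" by (auto simp: X_def)
    then show "\<exists>a\<in>X. \<exists>b\<in>X. a \<noteq> b \<and> {u, a} \<in> edges F \<and> {u, b} \<in> edges F"
    proof cases
      case 1
      then have "card (nbrs F u) \<ge> 2" using F D by (auto simp: factor_graph_def)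
      then obtain B where "card B = 2" "B \<subseteq> nbrs F u"
        by (metis obtain_subset_with_card_n)
      then obtain a b where "a \<in> nbrs F u" "b \<in> nbrs F u" "a \<noteq> b"
        by (auto simp: card_2_iff)
      with 1 show ?thesis by (auto simp: X_def nbrs_def)
    next
      case 2
      with no_leaf obtain c' where "c' \<in> D" "u \<in> nbrs F c'" "c' \<noteq> c" by blast
      with 2 show ?thesis by (auto simp: X_def nbrs_def insert_commute)
    qed
  qed
  with F show False by (simp add: acyclic_graph_def)
qed

text \<open>The induction runs over sets \<open>D\<close> of constraints with \<open>F\<close>
  fixed. Requiring all values in \<open>J\<close> is the strengthening that lets a leaf absorb the
  remaining sum.\<close>

lemma forest_satisfiable:
  fixes F :: "('v, 'r::comm_ring) wfgraph"
  assumes F: "factor_graph k F" "k \<ge> 2" "acyclic_graph F"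
    and edge: "\<And>e. e \<in> edges F \<Longrightarrow> edge_wt F e \<in> set_pmf P"
    and con: "\<And>c. c \<in> con_verts F \<Longrightarrow> con_wt F c \<in> I_ideal P n"
    and stable: "I_ideal P (Suc n) = I_ideal P n"
  shows "satisfiable F"
proof -
  \<comment> \<open>At index \<open>Suc n\<close>, edge weights map \<open>J\<close> into
    \<open>I\<^sub>n\<close>. By stability \<open>I\<^sub>n\<close> equals
    \<open>I\<^sub>n\<^sub>+\<^sub>1\<close>, which lies in \<open>r J\<close> for each edge weight
    \<open>r\<close>, so the leaf value returns to the same \<open>J\<close>.\<close>
  define J where "J = var_ideal P (Suc n)"
  have "finite D \<Longrightarrow> D \<subseteq> con_verts F \<Longrightarrow> \<exists>x :: 'v \<Rightarrow> 'r. (\<forall>v. x v \<in> J) \<and>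
      (\<forall>c\<in>D. (\<Sum>v\<in>nbrs F c. edge_wt F {c, v} * x v) = con_wt F c)" for D
  proof (induction D rule: finite_psubset_induct)
    case (psubset D)
    show ?case
    proof (cases "D = {}")
      case True
      then show ?thesis by (auto simp: J_def intro: var_ideal_subgroup exI[of _ "\<lambda>_. 0"])
    next
      case False
      from leaf_variable[OF F psubset.prems False] obtain c v where
        c: "c \<in> D" and v: "v \<in> nbrs F c" and leaf: "\<And>c'. \<lbrakk>c' \<in> D; v \<in> nbrs F c'\<rbrakk> \<Longrightarrow> c' = c"
        by blast
      obtain x :: "'v \<Rightarrow> 'r" where x: "\<And>v. x v \<in> J"
        and sol: "\<And>c'. c' \<in> D - {c} \<Longrightarrow> (\<Sum>v\<in>nbrs F c'. edge_wt F {c', v} * x v) = con_wt F c'"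
        using psubset.IH[of "D - {c}"] psubset.prems c by blast
      let ?rest = "\<Sum>u\<in>nbrs F c - {v}. edge_wt F {c, u} * x u"
      have "con_wt F c - ?rest \<in> I_ideal P n"
        using con c psubset.prems x edge
        by (intro I_ideal_diff I_ideal_sum) (auto simp: J_def mem_var_ideal_Suc nbrs_def)
      then obtain t where t: "t \<in> J" "con_wt F c - ?rest = edge_wt F {c, v} * t"
        using v edge[of "{c, v}"] unfolding J_def stable[symmetric] mem_I_ideal nbrs_def by blast
      show ?thesis
      proof (intro exI[of _ "x(v := t)"] conjI ballI allI)
        show "(x(v := t)) u \<in> J" for u using x t by simp
        fix c' assume c': "c' \<in> D"
        show "(\<Sum>u\<in>nbrs F c'. edge_wt F {c', u} * (x(v := t)) u) = con_wt F c'"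
        proof (cases "c' = c")
          case True
          have "(\<Sum>u\<in>nbrs F c. edge_wt F {c, u} * (x(v := t)) u)
              = edge_wt F {c, v} * t + (\<Sum>u\<in>nbrs F c - {v}. edge_wt F {c, u} * (x(v := t)) u)"
            using v finite_nbrs[OF F(1)] by (subst sum.remove[of _ v]) auto
          also have "(\<Sum>u\<in>nbrs F c - {v}. edge_wt F {c, u} * (x(v := t)) u) = ?rest"
            by (intro sum.cong) auto
          finally show ?thesis using True by (simp flip: t(2))
        next
          case False
          \<comment> \<open>Changing \<open>x\<close> at the leaf leaves the other constraints of
            \<open>D\<close> intact.\<close>
          then have "v \<notin> nbrs F c'" using leaf c' by blast
          then have "(\<Sum>u\<in>nbrs F c'. edge_wt F {c', u} * (x(v := t)) u)
              = (\<Sum>u\<in>nbrs F c'. edge_wt F {c', u} * x u)"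
            by (intro sum.cong) auto
          then show ?thesis using sol c' False by simp
        qed
      qed
    qed
  qed
  from this[of "con_verts F"] F show ?thesis
    by (auto simp: satisfiable_def factor_graph_def)
qed


section \<open>Relabelling vertices\<close>

text \<open>Transports the tree built below, whose vertices are lists, to the vertex type
  \<open>nat\<close> of \<open>unsat_trees\<close>. Weights are read at preimages, which is faithful
  for injective \<open>f\<close>.\<close>

definition relabel :: "('v \<Rightarrow> 'w) \<Rightarrow> ('v, 'r) wfgraph \<Rightarrow> ('w, 'r) wfgraph" where
  "relabel f F = \<lparr>var_verts = f ` var_verts F, con_verts = f ` con_verts F,
     edges = image f ` edges F, edge_wt = \<lambda>e. edge_wt F (f -` e),
     con_wt = \<lambda>c. con_wt F (inv f c)\<rparr>"

lemma relabel_simps [simp]: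
  "var_verts (relabel f F) = f ` var_verts F" "con_verts (relabel f F) = f ` con_verts F"
  "edges (relabel f F) = image f ` edges F"
  "edge_wt (relabel f F) e = edge_wt F (f -` e)"
  "con_wt (relabel f F) c = con_wt F (inv f c)"
  by (simp_all add: relabel_def)

context
  fixes f :: "'v \<Rightarrow> 'w"
  assumes inj: "inj f"
begin

lemma edge_relabel: "{f u, f v} \<in> edges (relabel f F) \<longleftrightarrow> {u, v} \<in> edges F"
proof -
  have "f ` {u, v} \<in> image f ` edges F \<longleftrightarrow> {u, v} \<in> edges F"
    by (auto simp only: image_iff inj_image_eq_iff[OF inj])
  then show ?thesis by simp
qed

lemma edge_relabelE:
  assumes "{a, b} \<in> edges (relabel f F)"
  obtains u v where "a = f u" "b = f v" "{u, v} \<in> edges F"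
proof -
  obtain e where e: "e \<in> edges F" "{a, b} = f ` e" using assms by auto
  then have "a \<in> f ` e" "b \<in> f ` e" by blast+
  then obtain u v where "a = f u" "b = f v" by blast
  with assms edge_relabel that show ?thesis by blast
qed

lemma nbrs_relabel: "nbrs (relabel f F) (f u) = f ` nbrs F u"
proof -
  have "b \<in> f ` nbrs F u" if "{f u, b} \<in> edges (relabel f F)" for b
    using that by (elim edge_relabelE) (auto simp: nbrs_def dest: injD[OF inj])
  then show ?thesis using edge_relabel by (auto simp: nbrs_def simp del: relabel_simps)
qed

lemma factor_graph_relabel:
  assumes "factor_graph k F"
  shows "factor_graph k (relabel f F)"
  unfolding factor_graph_def
proof (intro conjI ballI)
  show "var_verts (relabel f F) \<inter> con_verts (relabel f F) = {}"
    using assms inj by (auto simp: factor_graph_def dest: injD)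
  show "edges (relabel f F) \<subseteq> {{c, v} |c v. c \<in> con_verts (relabel f F) \<and> v \<in> var_verts (relabel f F)}"
  proof
    fix e assume "e \<in> edges (relabel f F)"
    then obtain e' where e': "e' \<in> edges F" "e = f ` e'" by auto
    with assms obtain c v where "e' = {c, v}" "c \<in> con_verts F" "v \<in> var_verts F"
      by (auto simp: factor_graph_def)
    with e' show "e \<in> {{c, v} |c v. c \<in> con_verts (relabel f F) \<and> v \<in> var_verts (relabel f F)}"
      by auto
  qed
  show "card (nbrs (relabel f F) c) = k" if "c \<in> con_verts (relabel f F)" for c
    using that assms
    by (auto simp: factor_graph_def nbrs_relabel card_image[OF inj_on_subset[OF inj subset_UNIV]])
qed (use assms in \<open>auto simp: factor_graph_def\<close>)

lemma connected_graph_relabel: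
  assumes "connected_graph F"
  shows "connected_graph (relabel f F)"
proof -
  have "(f u, f v) \<in> {(a, b). {a, b} \<in> edges (relabel f F)}\<^sup>*"
    if "(u, v) \<in> {(a, b). {a, b} \<in> edges F}\<^sup>*" for u v
    using that
  proof induction
    case (step v w)
    then have "(f v, f w) \<in> {(a, b). {a, b} \<in> edges (relabel f F)}"
      by (simp add: edge_relabel del: relabel_simps)
    with step.IH show ?case by (rule rtrancl_into_rtrancl)
  qed simp
  with assms show ?thesis by (auto simp: connected_graph_def simp del: relabel_simps(3))
qed

lemma acyclic_graph_relabel:
  assumes "acyclic_graph F"
  shows "acyclic_graph (relabel f F)"
  unfolding acyclic_graph_def
proof
  assume "\<exists>vs. graph_cycle (relabel f F) vs"
  then obtain vs where vs: "graph_cycle (relabel f F) vs" ..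
  \<comment> \<open>Each vertex of a cycle lies on an edge, and edges consist of images under
    \<open>f\<close>; hence the cycle lifts.\<close>
  have "a \<in> range f" if "a \<in> set vs" for a
    using that graph_cycle_nth[OF vs] by (metis edge_relabelE in_set_conv_nth rangeI)
  then obtain us where us: "vs = map f us"
    by (metis ex_map_conv rangeE)
  have "us \<noteq> []" using vs by (auto simp: graph_cycle_def us)
  then have "graph_cycle F us"
    using vs by (simp add: graph_cycle_def us successively_map edge_relabel distinct_map
        last_map hd_map del: relabel_simps)
  with assms show False by (auto simp: acyclic_graph_def)
qed

text \<open>A solution \<open>x\<close> pulls back to \<open>x \<circ> f\<close>; the contrapositive
  carries unsatisfiability over to the relabelled graph.\<close>

lemma satisfiable_relabel:
  assumes "satisfiable (relabel f F)"
  shows "satisfiable F"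
proof -
  have pre: "f -` {f u, f v} = {u, v}" for u v
    using inj by (auto dest: injD)
  obtain x where x: "\<And>c. c \<in> con_verts F \<Longrightarrow>
      (\<Sum>v\<in>nbrs (relabel f F) (f c). edge_wt F (f -` {f c, v}) * x v) = con_wt F c"
    using assms inj by (auto simp: satisfiable_def)
  have "(\<Sum>v\<in>nbrs F c. edge_wt F {c, v} * x (f v)) = con_wt F c" if "c \<in> con_verts F" for c
    using x[OF that]
    by (simp add: nbrs_relabel sum.reindex[OF inj_on_subset[OF inj subset_UNIV]] pre)
  then show ?thesis unfolding satisfiable_def by (intro exI[of _ "x \<circ> f"]) simp
qed

end


section \<open>Unsatisfiable trees\<close>

text \<open>
  A vertex is the path from it to the root, which is a constraint. The label \<open>Inr i\<close> marks the
  \<open>i\<close>-th child variable of a constraint. The label \<open>Inl (s, r)\<close> marks a child constraint of a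
  variable whose edge to that variable has weight \<open>s\<close> and whose other edges have weight \<open>r\<close>.
\<close>

type_synonym 'r vertex = "('r \<times> 'r + nat) list"

fun is_con :: "'r vertex \<Rightarrow> bool" where
  "is_con [] = True"
| "is_con (Inl _ # _) = True"
| "is_con (Inr _ # _) = False"

text \<open>A constraint other than the root has only \<open>k - 1\<close> children, since its
  parent is its remaining neighbour.\<close>

fun tree_vertex :: "nat \<Rightarrow> 'r set \<Rightarrow> 'r vertex \<Rightarrow> bool" where
  "tree_vertex k A [] = True"
| "tree_vertex k A (Inl (s, r) # v) \<longleftrightarrow> tree_vertex k A v \<and> \<not> is_con v \<and> s \<in> A \<and> r \<in> A"
| "tree_vertex k A (Inr i # c) \<longleftrightarrow>
     tree_vertex k A c \<and> is_con c \<and> i < (if c = [] then k else k - 1)"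

fun child_wt :: "'r \<Rightarrow> 'r vertex \<Rightarrow> 'r" where
  "child_wt r0 (Inl (s, r) # _) = r"
| "child_wt r0 _ = r0"

fun parent_edge_wt :: "'r \<Rightarrow> 'r vertex \<Rightarrow> 'r" where
  "parent_edge_wt r0 (Inl (s, r) # _) = s"
| "parent_edge_wt r0 (Inr i # c) = child_wt r0 c"
| "parent_edge_wt r0 [] = r0"

text \<open>The depth bound is odd, so the deepest vertices are variables and no constraint loses
  children to the truncation.\<close>

definition tree_set :: "nat \<Rightarrow> 'r set \<Rightarrow> nat \<Rightarrow> 'r vertex set" where
  "tree_set k A l = {p. tree_vertex k A p \<and> length p \<le> 2 * l + 1}"

text \<open>Edges are unordered, so the definite description recovers the child endpoint, at which
  the weight of the edge is stored.\<close>

definition tree_graph :: "nat \<Rightarrow> 'r set \<Rightarrow> nat \<Rightarrow> 'r \<Rightarrow> 'r \<Rightarrow> ('r vertex, 'r) wfgraph" where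
  "tree_graph k A l r0 q = \<lparr>var_verts = {p \<in> tree_set k A l. \<not> is_con p},
     con_verts = {p \<in> tree_set k A l. is_con p},
     edges = {{p, tl p} | p. p \<in> tree_set k A l \<and> p \<noteq> []},
     edge_wt = \<lambda>e. parent_edge_wt r0 (THE p. p \<in> e \<and> p \<noteq> [] \<and> tl p \<in> e),
     con_wt = \<lambda>_. q\<rparr>"

lemma tree_graph_simps [simp]:
  "var_verts (tree_graph k A l r0 q) = {p \<in> tree_set k A l. \<not> is_con p}"
  "con_verts (tree_graph k A l r0 q) = {p \<in> tree_set k A l. is_con p}"
  "edges (tree_graph k A l r0 q) = {{p, tl p} | p. p \<in> tree_set k A l \<and> p \<noteq> []}"
  "con_wt (tree_graph k A l r0 q) c = q"
  by (simp_all add: tree_graph_def)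

lemma edge_wt_tree_graph:
  "edge_wt (tree_graph k A l r0 q) {p, a # p} = parent_edge_wt r0 (a # p)"
  "edge_wt (tree_graph k A l r0 q) {a # p, p} = parent_edge_wt r0 (a # p)"
proof -
  have "(THE u. u \<in> {p, a # p} \<and> u \<noteq> [] \<and> tl u \<in> {p, a # p}) = a # p"
  proof (rule the_equality)
    fix u assume u: "u \<in> {p, a # p} \<and> u \<noteq> [] \<and> tl u \<in> {p, a # p}"
    \<comment> \<open>The lower endpoint is determined by length: the tail of \<open>p\<close> is
      shorter than both \<open>p\<close> and \<open>a # p\<close>.\<close>
    have False if "u = p"
    proof -
      have "tl p = p \<or> tl p = a # p" using u that by auto
      then have "length (tl p) = length p \<or> length (tl p) = length (a # p)" by (elim disjE) simp_all
      with u that show False by (cases p) auto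
    qed
    with u show "u = a # p" by blast
  qed simp
  then show "edge_wt (tree_graph k A l r0 q) {p, a # p} = parent_edge_wt r0 (a # p)"
    by (simp add: tree_graph_def)
  then show "edge_wt (tree_graph k A l r0 q) {a # p, p} = parent_edge_wt r0 (a # p)"
    by (simp add: insert_commute)
qed

lemma tree_vertex_length: "tree_vertex k A p \<Longrightarrow> is_con p \<longleftrightarrow> even (length p)"
  by (induction k A p rule: tree_vertex.induct) auto

lemma tree_set_tl: "p \<in> tree_set k A l \<Longrightarrow> tl p \<in> tree_set k A l"
  by (cases "(k, A, p)" rule: tree_vertex.cases) (auto simp: tree_set_def)

lemma is_con_tl: "tree_vertex k A p \<Longrightarrow> p \<noteq> [] \<Longrightarrow> is_con (tl p) \<longleftrightarrow> \<not> is_con p"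
  by (cases "(k, A, p)" rule: tree_vertex.cases) auto

lemma finite_tree_set:
  assumes "finite A"
  shows "finite (tree_set k A l)"
proof (rule finite_subset)
  let ?L = "Inl ` (A \<times> A) \<union> Inr ` {..<k}"
  have "tree_vertex k A p \<Longrightarrow> set p \<subseteq> ?L" for p
    by (induction k A p rule: tree_vertex.induct) (auto split: if_splits)
  then show "tree_set k A l \<subseteq> {p. set p \<subseteq> ?L \<and> length p \<le> 2 * l + 1}"
    by (auto simp: tree_set_def)
  show "finite {p. set p \<subseteq> ?L \<and> length p \<le> 2 * l + 1}"
    using assms by (intro finite_lists_length_le) auto
qed

section \<open>Neighbourhoods in the tree\<close>

lemma mem_nbrs_tree_graph:
  "v \<in> nbrs (tree_graph k A l r0 q) u \<longleftrightarrow>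
     u \<in> tree_set k A l \<and> u \<noteq> [] \<and> v = tl u \<or> v \<in> tree_set k A l \<and> v \<noteq> [] \<and> u = tl v"
  by (auto simp: nbrs_def doubleton_eq_iff)

text \<open>Constraints have even length, hence never the maximal length \<open>2 * l + 1\<close>,
  and all their children are present.\<close>

lemma con_child_in_tree_set:
  assumes "c \<in> tree_set k A l" "is_con c"
  shows "a # c \<in> tree_set k A l \<longleftrightarrow> (\<exists>i < (if c = [] then k else k - 1). a = Inr i)"
proof -
  have "length c \<noteq> 2 * l + 1"
    using assms tree_vertex_length[of k A c] by (auto simp: tree_set_def)
  with assms show ?thesis
    by (cases a) (auto simp: tree_set_def split: if_splits)
qed

lemma nbrs_constraint:
  assumes "c \<in> tree_set k A l" "is_con c"
  shows "nbrs (tree_graph k A l r0 q) c =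
    (if c = [] then {} else {tl c}) \<union> (\<lambda>i. Inr i # c) ` {..<if c = [] then k else k - 1}"
proof (rule set_eqI)
  fix v
  have "v \<in> tree_set k A l \<and> v \<noteq> [] \<and> c = tl v \<longleftrightarrow> (\<exists>a. a # c \<in> tree_set k A l \<and> v = a # c)"
    by (cases v) auto
  also have "\<dots> \<longleftrightarrow> v \<in> (\<lambda>i. Inr i # c) ` {..<if c = [] then k else k - 1}"
    unfolding con_child_in_tree_set[OF assms] by blast
  finally show "v \<in> nbrs (tree_graph k A l r0 q) c \<longleftrightarrow>
      v \<in> (if c = [] then {} else {tl c}) \<union> (\<lambda>i. Inr i # c) ` {..<if c = [] then k else k - 1}"
    using assms(1) unfolding mem_nbrs_tree_graph by simp
qed

lemma nbrs_root: "nbrs (tree_graph k A l r0 q) [] = (\<lambda>i. [Inr i]) ` {..<k}"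
  by (subst nbrs_constraint) (simp_all add: tree_set_def)

lemma nbrs_non_root_constraint:
  assumes "Inl a # v \<in> tree_set k A l"
  shows "nbrs (tree_graph k A l r0 q) (Inl a # v) = insert v ((\<lambda>i. Inr i # Inl a # v) ` {..<k - 1})"
  using nbrs_constraint[OF assms] by simp

section \<open>Factor graph axioms, acyclicity, connectedness and weights\<close>

lemma factor_graph_tree_graph:
  assumes "finite A" "k \<ge> 1"
  shows "factor_graph k (tree_graph k A l r0 q)"
  unfolding factor_graph_def
proof (intro conjI ballI)
  show "finite (var_verts (tree_graph k A l r0 q))" "finite (con_verts (tree_graph k A l r0 q))"
    using finite_tree_set[OF assms(1), of k l] by simp_all
  show "edges (tree_graph k A l r0 q) \<subseteq>
      {{c, v} |c v. c \<in> con_verts (tree_graph k A l r0 q) \<and> v \<in> var_verts (tree_graph k A l r0 q)}"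
  proof
    fix e assume "e \<in> edges (tree_graph k A l r0 q)"
    then obtain p where p: "e = {p, tl p}" "p \<in> tree_set k A l" "p \<noteq> []" by auto
    then have "is_con (tl p) \<longleftrightarrow> \<not> is_con p" by (auto simp: tree_set_def is_con_tl)
    with p tree_set_tl[OF p(2)]
    show "e \<in> {{c, v} |c v. c \<in> con_verts (tree_graph k A l r0 q) \<and>
        v \<in> var_verts (tree_graph k A l r0 q)}"
      by (cases "is_con p") (auto intro: insert_commute)
  qed
  fix c assume c: "c \<in> con_verts (tree_graph k A l r0 q)"
  then show "card (nbrs (tree_graph k A l r0 q) c) = k"
  proof (cases c rule: is_con.cases)
    case 1
    then show ?thesis by (simp add: nbrs_root card_image inj_on_def)
  next
    case (2 a v)
    \<comment> \<open>The parent differs from the \<open>k - 1\<close> children, which gives degree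
      \<open>k\<close>.\<close>
    have "v \<notin> (\<lambda>i. Inr i # Inl a # v) ` {..<k - 1}" by auto
    with 2 c assms show ?thesis by (simp add: nbrs_non_root_constraint card_image inj_on_def)
  qed simp
qed auto

lemma acyclic_tree_graph: "acyclic_graph (tree_graph k A l r0 q)"
  by (rule acyclic_if_parent[where p = tl and d = length]) auto

lemma connected_tree_graph: "connected_graph (tree_graph k A l r0 q)"
proof -
  let ?E = "{(a, b). {a, b} \<in> edges (tree_graph k A l r0 q)}"
  have "p \<in> tree_set k A l \<Longrightarrow> (p, []) \<in> ?E\<^sup>*" for p
  proof (induction "length p" arbitrary: p)
    case (Suc n)
    then have "(tl p, []) \<in> ?E\<^sup>*" by (intro Suc tree_set_tl) auto
    moreover have "(p, tl p) \<in> ?E" using Suc by auto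
    ultimately show ?case by (rule converse_rtrancl_into_rtrancl[rotated])
  qed simp
  moreover have "sym (?E\<^sup>*)" by (intro sym_rtrancl symI) (simp add: insert_commute)
  ultimately show ?thesis
    unfolding connected_graph_def by (auto dest: symD intro: rtrancl_trans)
qed

lemma edge_wt_tree_graph_in:
  assumes "e \<in> edges (tree_graph k A l r0 q)" "r0 \<in> A"
  shows "edge_wt (tree_graph k A l r0 q) e \<in> A"
proof -
  obtain a p where p: "e = {a # p, p}" "tree_vertex k A (a # p)"
    using assms by (auto simp: tree_set_def neq_Nil_conv)
  have "child_wt r0 p \<in> A" if "tree_vertex k A p" for p
    using that assms(2) by (cases "(k, A, p)" rule: tree_vertex.cases) auto
  with p show ?thesis
    by (cases "(k, A, a # p)" rule: tree_vertex.cases) (auto simp: edge_wt_tree_graph)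
qed

lemma tree_graph_unsatisfiable:
  assumes r0: "r0 \<in> set_pmf P" "\<And>t. t \<in> var_ideal P l \<Longrightarrow> q \<noteq> r0 * t"
    and q: "\<And>m. m < l \<Longrightarrow> q \<in> I_ideal P m"
  shows "\<not> satisfiable (tree_graph k (set_pmf P) l r0 q)"
proof
  let ?T = "tree_set k (set_pmf P) l" and ?F = "tree_graph k (set_pmf P) l r0 q"
  assume "satisfiable ?F"
  then obtain x where x: "\<And>c. c \<in> ?T \<Longrightarrow> is_con c \<Longrightarrow>
      (\<Sum>v\<in>nbrs ?F c. edge_wt ?F {c, v} * x v) = q"
    by (auto simp: satisfiable_def)
  \<comment> \<open>The third premise says that at least \<open>2 * n\<close> levels lie below
    \<open>v\<close>; the induction climbs two levels at a time.\<close>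
  have var: "x v \<in> var_ideal P n" if "v \<in> ?T" "\<not> is_con v" "length v + 2 * n \<le> 2 * l + 1" for v n
    using that
  proof (induction n arbitrary: v)
    case (Suc n)
    show ?case
      unfolding mem_var_ideal_Suc mem_I_ideal
    proof (intro ballI)
      fix s r assume sr: "s \<in> set_pmf P" "r \<in> set_pmf P"
      let ?c = "Inl (s, r) # v"
      have c: "?c \<in> ?T" using Suc.prems sr by (auto simp: tree_set_def)
      \<comment> \<open>All child edges of \<open>?c\<close> carry the same weight \<open>r\<close>,
        so its equation reads \<open>s * x v + r * y = q\<close>.\<close>
      define y where "y = (\<Sum>i<k - 1. x (Inr i # ?c))"
      have "y \<in> var_ideal P n"
        unfolding y_def
      proof (intro var_ideal_sum Suc.IH)
        fix i assume "i \<in> {..<k - 1}"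
        then show "Inr i # ?c \<in> ?T"
          using con_child_in_tree_set[OF c] by auto
      qed (use Suc.prems in auto)
      have notin: "v \<notin> (\<lambda>i. Inr i # ?c) ` {..<k - 1}" by auto
      have "(\<Sum>u\<in>nbrs ?F ?c. edge_wt ?F {?c, u} * x u) = s * x v + r * y"
        unfolding nbrs_non_root_constraint[OF c]
        by (subst sum.insert[OF _ notin])
          (simp_all add: sum.reindex inj_on_def edge_wt_tree_graph y_def sum_distrib_left)
      with x[OF c] have eq: "s * x v = q - r * y" by (simp add: algebra_simps)
      \<comment> \<open>The length bound forces \<open>n < l\<close>, so \<open>q\<close> lies in
        \<open>I\<^sub>n\<close> and hence in \<open>r J\<^sub>n\<close>.\<close>
      obtain t where "t \<in> var_ideal P n" "q = r * t"
        using q[of n] Suc.prems sr unfolding mem_I_ideal by (auto simp: Suc_le_eq)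
      with eq \<open>y \<in> var_ideal P n\<close> show "\<exists>t\<in>var_ideal P n. s * x v = r * t"
        by (intro bexI[of _ "t - y"] var_ideal_subgroup) (simp_all add: right_diff_distrib)
    qed
  qed simp
  have root: "[] \<in> ?T" by (simp add: tree_set_def)
  have "(\<Sum>u\<in>nbrs ?F []. edge_wt ?F {[], u} * x u) = r0 * (\<Sum>i<k. x [Inr i])"
    unfolding nbrs_root
    by (simp add: sum.reindex inj_on_def edge_wt_tree_graph sum_distrib_left)
  with x[OF root] have "q = r0 * (\<Sum>i<k. x [Inr i])" by simp
  \<comment> \<open>The children of the root have length 1, for which the bound on heights holds
    exactly with \<open>n = l\<close>.\<close>
  moreover have "(\<Sum>i<k. x [Inr i]) \<in> var_ideal P l"
    by (intro var_ideal_sum var) (auto simp: tree_set_def)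
  ultimately show False using r0 by blast
qed


section \<open>The characterization\<close>

lemma unsat_trees_empty_iff:
  fixes P Q :: "'r::{finite, comm_ring} pmf"
  assumes "k \<ge> 2"
  shows "unsat_trees k P Q = {} \<longleftrightarrow> (\<forall>l. set_pmf Q \<subseteq> I_ideal P l)"
proof
  assume sub: "\<forall>l. set_pmf Q \<subseteq> I_ideal P l"
  obtain n where "I_ideal P (Suc n) = I_ideal P n" by (rule I_ideal_stabilizes)
  with sub assms show "unsat_trees k P Q = {}"
    using forest_satisfiable[of k _ P n] by (fastforce simp: unsat_trees_def)
next
  assume empty: "unsat_trees k P Q = {}"
  show "\<forall>l. set_pmf Q \<subseteq> I_ideal P l"
  proof (rule ccontr)
    assume "\<not> (\<forall>l. set_pmf Q \<subseteq> I_ideal P l)"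
    then obtain q where q: "q \<in> set_pmf Q" and ex: "\<exists>l. q \<notin> I_ideal P l" by blast
    \<comment> \<open>Minimality puts \<open>q\<close> in every earlier \<open>I\<^sub>m\<close>, as
      the forcing argument in the tree requires.\<close>
    define l where "l = (LEAST l. q \<notin> I_ideal P l)"
    have "q \<notin> I_ideal P l" unfolding l_def by (rule LeastI_ex[OF ex])
    then obtain r0 where r0: "r0 \<in> set_pmf P" "\<And>t. t \<in> var_ideal P l \<Longrightarrow> q \<noteq> r0 * t"
      unfolding mem_I_ideal by blast
    have less: "q \<in> I_ideal P m" if "m < l" for m
      using not_less_Least[of m "\<lambda>l. q \<notin> I_ideal P l"] that unfolding l_def by blast
    let ?F = "tree_graph k (set_pmf P) l r0 q" and ?f = "to_nat :: 'r vertex \<Rightarrow> nat"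
    have inj: "inj ?f" by simp
    have "relabel ?f ?F \<in> unsat_trees k P Q"
      unfolding unsat_trees_def
    proof (intro CollectI conjI ballI)
      show "factor_graph k (relabel ?f ?F)"
        using assms by (intro factor_graph_relabel inj factor_graph_tree_graph) auto
      show "connected_graph (relabel ?f ?F)"
        by (intro connected_graph_relabel inj connected_tree_graph)
      show "acyclic_graph (relabel ?f ?F)"
        by (intro acyclic_graph_relabel inj acyclic_tree_graph)
      show "\<not> satisfiable (relabel ?f ?F)"
        using satisfiable_relabel[OF inj] tree_graph_unsatisfiable[OF r0 less] by blast
      show "con_wt (relabel ?f ?F) c \<in> set_pmf Q" for c using q by simp
      fix e assume "e \<in> edges (relabel ?f ?F)"
      then obtain e' where e': "e' \<in> edges ?F" "e = ?f ` e'" by (auto simp del: tree_graph_simps)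
      then show "edge_wt (relabel ?f ?F) e \<in> set_pmf P"
        using edge_wt_tree_graph_in[OF e'(1) r0(1)] by (simp add: inj_vimage_image_eq[OF inj])
    qed
    with empty show False by blast
  qed
qed

text \<open>The infimum of a nonempty set of naturals is attained, and an unsatisfiable graph has a
  constraint. So the infimum is positive, which rules out the degenerate value
  \<open>1 / 0 = 0\<close>.\<close>

lemma alpha_eq_1_iff: "alpha k P Q = 1 \<longleftrightarrow> unsat_trees k P Q = {}"
proof (cases "unsat_trees k P Q = {}")
  case False
  then have "(INF T \<in> unsat_trees k P Q. card (con_verts T)) \<in>
      (\<lambda>T. card (con_verts T)) ` unsat_trees k P Q"
    by (intro Inf_nat_def1) simp
  moreover have "card (con_verts T) \<noteq> 0" if "T \<in> unsat_trees k P Q" for T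
    using that by (auto simp: unsat_trees_def factor_graph_def satisfiable_def)
  ultimately have "(INF T \<in> unsat_trees k P Q. card (con_verts T)) \<noteq> 0" by fastforce
  with False show ?thesis by (simp add: alpha_def)
qed (simp add: alpha_def)

lemma ell_eq_infinity_iff: "ell P Q = \<infinity> \<longleftrightarrow> (\<forall>l. set_pmf Q \<subseteq> I_ideal P l)"
proof
  assume inf: "ell P Q = \<infinity>"
  show "\<forall>l. set_pmf Q \<subseteq> I_ideal P l"
  proof (rule ccontr)
    assume "\<not> (\<forall>l. set_pmf Q \<subseteq> I_ideal P l)"
    then obtain l where "\<not> set_pmf Q \<subseteq> I_ideal P l" by blast
    then have "ell P Q \<le> enat l" unfolding ell_def by (intro Inf_lower) blast
    with inf show False by simp
  qed
next
  assume "\<forall>l. set_pmf Q \<subseteq> I_ideal P l"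
  then show "ell P Q = \<infinity>" by (simp add: ell_def top_enat_def)
qed

theorem theorem1p9:
  fixes k :: nat
    and P Q :: "'r :: {finite, comm_ring, comm_monoid_mult} pmf"
  assumes "k \<ge> 3"
  shows "alpha k P Q = 1 \<longleftrightarrow> ell P Q = \<infinity>"
  using assms by (simp add: alpha_eq_1_iff ell_eq_infinity_iff unsat_trees_empty_iff)

end
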